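(* Fix a numbering $b_0,b_1,b_2$ of the branches of the triod $T$, and consider the regular patterns for which this numbering is canonical. Let $\pi_3$ be the pattern of the primitive cycle of period $3$, which has rotation number $\frac13$ with respect to this numbering (its point on $b_i$ is mapped to its point on $b_{i+1}$, indices mod $3$). Then $\pi_3$ is the unique triod twist pattern with rotation number $\frac13$.
   Context: The triod is $T=\{z\in\mathbb{C}: z^3\in[0,1]\}$, with central (branching) point $a=0$; the branches of $T$ are the three components of $T\setminus\{a\}$. Let $\mathcal{U}$ be the set of continuous maps $f:T\to T$ for which $a$ is the unique fixed point. A cycle is a periodic orbit $P\neq\{a\}$ of some $f\in\mathcal{U}$; $[P]$ is its convex hull in $T$. Cycles $P$ of $f$ and $Q$ of $g$ are equivalent if there is a homeomorphism $h:[P]\to[Q]$ with $h(P)=Q$ and $h\circ f=g\circ h$ on $P$, which fixes branches (points of each branch are sent into the same branch). The equivalence class of $P$ is its pattern, and $P$ exhibits that pattern. A pattern $A$ forces a pattern $B$ if every $f\in\mathcal{U}$ with a cycle of pattern $A$ also has a cycle of pattern $B$. A cycle and its pattern are primitive if each point of the cycle lies on a different branch. A pattern is regular if it does not force a primitive pattern of period $2$; a cycle is regular if its pattern is. For $u\in b_i$, $v\in b_j$ (indices mod $3$) put $d(u,v)=\frac k3$, where $k\in\{0,1,2\}$ and $j\equiv i+k \pmod 3$. For a cycle $P$ of $f$, a point $x\in P$ is green, black or red according as $d(x,f(x))=0,\frac13,\frac23$. If $P$ has period $n$, its rotation pair is $\left(\sum_{i=0}^{n-1}d(f^i(x),f^{i+1}(x)),\,n\right)$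 for $x\in P$ (the first entry is an integer), and its rotation number is the quotient of the first entry by the second; these depend only on the pattern. The numbering is canonical for a regular cycle (or its pattern) if, for each $i$, the point of the cycle on $b_i$ closest to $a$ is black. All rotation numbers are computed with the fixed numbering. A triod twist is a regular pattern that does not force another pattern with the same rotation number. *)

theory Defs
  imports "HOL-Analysis.Analysis"
begin

section \<open>The triod and its cycles\<close>

definition triod :: "complex set" where
  "triod = {z. z ^ 3 \<in> complex_of_real ` {0..1}}"

text \<open>The central point is \<open>0\<close>.\<close>

definition branches :: "complex set set" where
  "branches = components (triod - {0})"

text \<open>Maps of the triod are total functions on the complex plane; their values outside
  the triod play no role.\<close>

definition triod_maps :: "(complex \<Rightarrow> complex) set" where
  "triod_maps = {f. continuous_on triod f \<and> f ` triod \<subseteq> triod \<and> (\<forall>z\<in>triod. f z = z \<longleftrightarrow> z = 0)}"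

text \<open>The convex hull in a tree is the smallest connected subset of the tree.\<close>

definition triod_hull :: "complex set \<Rightarrow> complex set" where
  "triod_hull P = (\<lambda>S. S \<subseteq> triod \<and> connected S) hull P"

definition periodic_orbit :: "(complex \<Rightarrow> complex) \<Rightarrow> complex set \<Rightarrow> bool" where
  "periodic_orbit f P \<longleftrightarrow>
     (\<exists>x\<in>triod. \<exists>n>0. (f ^^ n) x = x \<and> P = (\<lambda>i. (f ^^ i) x) ` {..<n})"

text \<open>A cycle is recorded together with the map it belongs to. Its period is \<open>card P\<close>.\<close>

type_synonym cycle = "(complex \<Rightarrow> complex) \<times> complex set"

definition cycles :: "cycle set" where
  "cycles = {(f, P). f \<in> triod_maps \<and> periodic_orbit f P \<and> P \<noteq> {0}}"

definition primitive_cycle :: "cycle \<Rightarrow> bool" where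
  "primitive_cycle = (\<lambda>(f, P). \<forall>B\<in>branches. \<forall>x\<in>P \<inter> B. \<forall>y\<in>P \<inter> B. x = y)"

section \<open>Patterns and forcing\<close>

definition cycle_equiv :: "(cycle \<times> cycle) set" where
  "cycle_equiv = {((f, P), (g, Q)). (f, P) \<in> cycles \<and> (g, Q) \<in> cycles \<and>
     (\<exists>h h'. homeomorphism (triod_hull P) (triod_hull Q) h h' \<and> h ` P = Q \<and>
        (\<forall>x\<in>P. h (f x) = g (h x)) \<and>
        (\<forall>B\<in>branches. h ` (triod_hull P \<inter> B) \<subseteq> B))}"

type_synonym pattern = "cycle set"

definition patterns :: "pattern set" where
  "patterns = cycles // cycle_equiv"

definition forces :: "pattern \<Rightarrow> pattern \<Rightarrow> bool" where
  "forces A B \<longleftrightarrow> (\<forall>f\<in>triod_maps. (\<exists>P. (f, P) \<in> A) \<longrightarrow> (\<exists>Q. (f, Q) \<in> B))"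

text \<open>Primitivity, the period, the rotation number and canonicity are invariants of the
  equivalence class; for numerical invariants this is what makes \<open>the_elem\<close> below apply to
  a singleton.\<close>

definition primitive_pattern :: "pattern \<Rightarrow> bool" where
  "primitive_pattern A \<longleftrightarrow> (\<forall>c\<in>A. primitive_cycle c)"

definition pattern_period :: "pattern \<Rightarrow> nat" where
  "pattern_period A = the_elem ((\<lambda>(f, P). card P) ` A)"

definition regular_pattern :: "pattern \<Rightarrow> bool" where
  "regular_pattern A \<longleftrightarrow>
     A \<in> patterns \<and> \<not> (\<exists>B\<in>patterns. primitive_pattern B \<and> pattern_period B = 2 \<and> forces A B)"

section \<open>Numberings of the branches and rotation numbers\<close>

text \<open>Only the values of \<open>b\<close> at \<open>0, 1, 2\<close> matter.\<close>

definition branch_numbering :: "(nat \<Rightarrow> complex set) \<Rightarrow> bool" where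
  "branch_numbering b \<longleftrightarrow> bij_betw b {..<3} branches"

definition branch_index :: "(nat \<Rightarrow> complex set) \<Rightarrow> complex \<Rightarrow> nat" where
  "branch_index b u = (THE i. i < 3 \<and> u \<in> b i)"

definition branch_dist :: "(nat \<Rightarrow> complex set) \<Rightarrow> complex \<Rightarrow> complex \<Rightarrow> real" where
  "branch_dist b u v = of_int ((int (branch_index b v) - int (branch_index b u)) mod 3) / 3"

definition black :: "(nat \<Rightarrow> complex set) \<Rightarrow> (complex \<Rightarrow> complex) \<Rightarrow> complex \<Rightarrow> bool" where
  "black b f x \<longleftrightarrow> branch_dist b x (f x) = 1 / 3"

text \<open>The pair does not depend on the point \<open>x\<close> of the cycle.\<close>

definition rotation_pair :: "(nat \<Rightarrow> complex set) \<Rightarrow> cycle \<Rightarrow> real \<times> nat" where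
  "rotation_pair b = (\<lambda>(f, P). the_elem
     ((\<lambda>x. (\<Sum>i<card P. branch_dist b ((f ^^ i) x) ((f ^^ Suc i) x), card P)) ` P))"

definition cycle_rotation_number :: "(nat \<Rightarrow> complex set) \<Rightarrow> cycle \<Rightarrow> real" where
  "cycle_rotation_number b c = fst (rotation_pair b c) / real (snd (rotation_pair b c))"

definition rotation_number :: "(nat \<Rightarrow> complex set) \<Rightarrow> pattern \<Rightarrow> real" where
  "rotation_number b A = the_elem (cycle_rotation_number b ` A)"

text \<open>The point of \<open>P\<close> on each branch closest to the centre is required to exist: a cycle
  missing a branch has no canonical numbering.\<close>

definition canonical_for_cycle :: "(nat \<Rightarrow> complex set) \<Rightarrow> cycle \<Rightarrow> bool" where
  "canonical_for_cycle b = (\<lambda>(f, P).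
     \<forall>i<3. \<exists>x\<in>P \<inter> b i. (\<forall>y\<in>P \<inter> b i. dist 0 x \<le> dist 0 y) \<and> black b f x)"

definition canonical_regular_patterns :: "(nat \<Rightarrow> complex set) \<Rightarrow> pattern set" where
  "canonical_regular_patterns b =
     {A. regular_pattern A \<and> (\<forall>c\<in>A. canonical_for_cycle b c)}"

definition triod_twist :: "(nat \<Rightarrow> complex set) \<Rightarrow> pattern \<Rightarrow> bool" where
  "triod_twist b A \<longleftrightarrow> regular_pattern A \<and>
     \<not> (\<exists>B\<in>patterns. B \<noteq> A \<and> forces A B \<and> rotation_number b B = rotation_number b A)"

definition pi3 :: "(nat \<Rightarrow> complex set) \<Rightarrow> pattern" where
  "pi3 b = (THE A. \<exists>f P. (f, P) \<in> cycles \<and> A = cycle_equiv `` {(f, P)} \<and>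
     primitive_cycle (f, P) \<and> card P = 3 \<and>
     (\<forall>i<3. \<forall>x\<in>P \<inter> b i. f x \<in> b ((i + 1) mod 3)))"

end

theory Submission
  imports Defs
begin

text \<open>A canonical cycle contains points \<open>p i\<close> on the branches \<open>b i\<close>, closest to the centre, whose
  images lie on \<open>b (i + 1)\<close> at least as far out as \<open>p (i + 1)\<close>. Pulling \<open>p 0\<close> back along the
  three branches gives a point of \<open>b 0\<close> which the threefold passage around the triod (truncated
  to the centre when it misses the next branch) moves away from the centre, whereas the end
  point of \<open>b 0\<close> cannot be moved outwards; so the passage has a fixed point other than the
  centre, which lies on a primitive three-cycle. Conversely, all cycles of the
  rigid rotation of the triod are such three-cycles, hence their pattern forces only itself.\<close>

section \<open>Coordinates on the triod\<close>

lemma norm_cube_root_unity: "w ^ 3 = 1 \<Longrightarrow> norm w = 1" for w :: complex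
  using power_eq_1_iff[of w 3] by simp

text \<open>The quotient \<open>u = v * cnj w\<close> is a cube root of unity other than 1, hence a
  zero of u^2 + u + 1, so its real part is -1/2; and \<open>inner w v\<close> is
  \<open>Re u\<close>.\<close>

lemma inner_distinct_cube_roots:
  fixes v w :: complex
  assumes "v ^ 3 = 1" "w ^ 3 = 1" "v \<noteq> w"
  shows "inner w v < 0"
proof -
  define u where "u = v * cnj w"
  have w1: "w * cnj w = 1"
    using norm_cube_root_unity[OF assms(2)] by (simp add: complex_norm_square[symmetric])
  have "u ^ 3 = 1"
    using assms by (simp add: u_def power_mult_distrib flip: complex_cnj_power)
  moreover have "u \<noteq> 1"
  proof
    assume "u = 1"
    then have "v * (w * cnj w) = w"
      by (simp add: u_def algebra_simps)
    with w1 assms show False by simp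
  qed
  moreover have "u ^ 3 - 1 = (u - 1) * (u\<^sup>2 + u + 1)"
    by (simp add: algebra_simps power2_eq_square power3_eq_cube)
  ultimately have "u\<^sup>2 + u + 1 = 0" by simp
  then have "(Re u)\<^sup>2 - (Im u)\<^sup>2 + Re u + 1 = 0" "2 * Re u * Im u + Im u = 0"
    by (auto simp: complex_eq_iff Re_power2 Im_power2)
  \<comment> \<open>With \<open>Im u = 0\<close> the real-part equation would make this positive
    quantity zero; so \<open>Im u\<close> can be cancelled from the imaginary-part equation.\<close>
  moreover have "(Re u)\<^sup>2 + Re u + 1 > 0"
  proof -
    have "(Re u)\<^sup>2 + Re u + 1 = (Re u + 1/2)\<^sup>2 + 3/4" by (simp add: power2_eq_square algebra_simps)
    then show ?thesis using zero_le_power2[of "Re u + 1/2"] by linarith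
  qed
  ultimately have "Im u \<noteq> 0" "(2 * Re u + 1) * Im u = 0"
    by (auto simp: algebra_simps)
  then have "Re u < 0" by simp
  then show ?thesis by (simp add: u_def inner_complex_def algebra_simps)
qed

lemma triod_iff: "z \<in> triod \<longleftrightarrow> (\<exists>r w. w ^ 3 = 1 \<and> 0 \<le> r \<and> r \<le> 1 \<and> z = r *\<^sub>R w)"
proof
  assume "z \<in> triod"
  then obtain s where s: "0 \<le> s" "s \<le> 1" "z ^ 3 = complex_of_real s"
    by (auto simp: triod_def)
  have n: "norm z ^ 3 = s"
    using arg_cong[OF s(3), of norm] s(1) by (simp add: norm_power)
  have "norm z \<le> 1"
    using n s one_less_power[of "norm z" 3] by linarith
  show "\<exists>r w. w ^ 3 = 1 \<and> 0 \<le> r \<and> r \<le> 1 \<and> z = r *\<^sub>R w"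
  proof (cases "z = 0")
    case True
    then show ?thesis by (intro exI[of _ 0] exI[of _ 1]) auto
  next
    case False
    have "(z / of_real (norm z)) ^ 3 = 1"
      using s n False by (auto simp: power_divide simp flip: of_real_power)
    with \<open>norm z \<le> 1\<close> False show ?thesis
      by (intro exI[of _ "norm z"] exI[of _ "z / of_real (norm z)"]) (auto simp: scaleR_conv_of_real)
  qed
next
  assume "\<exists>r w. w ^ 3 = 1 \<and> 0 \<le> r \<and> r \<le> 1 \<and> z = r *\<^sub>R w"
  then obtain r w where "w ^ 3 = 1" "0 \<le> r" "r \<le> 1" "z = r *\<^sub>R w" by auto
  then have "z ^ 3 = complex_of_real (r ^ 3)" "0 \<le> r ^ 3" "r ^ 3 \<le> 1"
    by (auto simp: scaleR_conv_of_real power_mult_distrib power_le_one)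
  then show "z \<in> triod" unfolding triod_def by (intro CollectI image_eqI[of _ _ "r ^ 3"]) auto
qed

lemma scaleR_in_triod: "w ^ 3 = 1 \<Longrightarrow> 0 \<le> r \<Longrightarrow> r \<le> 1 \<Longrightarrow> r *\<^sub>R w \<in> triod"
  by (auto simp: triod_iff)

lemma zero_in_triod: "0 \<in> triod"
  by (simp add: triod_def)

lemma inner_cube_root_self: "w ^ 3 = 1 \<Longrightarrow> inner w w = 1" for w :: complex
  using norm_cube_root_unity by (simp add: dot_square_norm)

text \<open>On the triod, the linear form \<open>inner w\<close> is the radial coordinate on the branch through
  \<open>w\<close> and negative on the other two branches, so that it detects that branch.\<close>

lemma triod_inner_nonneg:
  assumes "z \<in> triod" "w ^ 3 = 1" "inner w z \<ge> 0"
  shows "z = inner w z *\<^sub>R w"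
proof -
  obtain r v where v: "v ^ 3 = 1" "0 \<le> r" "z = r *\<^sub>R v"
    using assms(1) by (auto simp: triod_iff)
  show ?thesis
  proof (cases "v = w")
    case True
    then show ?thesis using v inner_cube_root_self by simp
  next
    case False
    then have "r = 0"
      using inner_distinct_cube_roots[OF v(1) assms(2)] v assms(3)
      by (auto simp: zero_le_mult_iff)
    then show ?thesis using v by simp
  qed
qed

lemma triod_inner_le_one:
  assumes "z \<in> triod" "w ^ 3 = 1"
  shows "inner w z \<le> 1"
proof -
  have "norm z \<le> 1" using assms(1) by (auto simp: triod_iff norm_cube_root_unity)
  then show ?thesis
    using Cauchy_Schwarz_ineq2[of w z] norm_cube_root_unity[OF assms(2)] by simp
qed

text \<open>The sign of a linear form describes a branch, so that connectedness arguments reduce to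
  intermediate values of \<open>inner w\<close>; \<open>ray_eq\<close> recovers the half-open
  segment.\<close>

definition ray :: "complex \<Rightarrow> complex set" where
  "ray w = {z \<in> triod. inner w z > 0}"

lemma ray_eq:
  assumes "w ^ 3 = 1"
  shows "ray w = (\<lambda>r. r *\<^sub>R w) ` {0<..1}"
proof (intro subset_antisym subsetI)
  fix z assume "z \<in> ray w"
  then show "z \<in> (\<lambda>r. r *\<^sub>R w) ` {0<..1}"
    using triod_inner_nonneg triod_inner_le_one assms
    by (intro image_eqI[of _ _ "inner w z"]) (auto simp: ray_def)
next
  fix z assume "z \<in> (\<lambda>r. r *\<^sub>R w) ` {0<..1}"
  then show "z \<in> ray w"
    using assms scaleR_in_triod inner_cube_root_self by (auto simp: ray_def)
qed

section \<open>Branches as connected components\<close>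

lemma triod_minus_zero_cover: "triod - {0} = (\<Union>w\<in>{w. w ^ 3 = 1}. ray w)"
proof (intro subset_antisym subsetI)
  fix z assume "z \<in> triod - {0}"
  then obtain r w where "w ^ 3 = 1" "0 \<le> r" "r \<le> 1" "z = r *\<^sub>R w" "z \<noteq> 0"
    by (auto simp: triod_iff)
  then show "z \<in> (\<Union>w\<in>{w. w ^ 3 = 1}. ray w)"
    by (auto simp: ray_eq image_iff intro!: exI[of _ w] bexI[of _ r])
qed (auto simp: ray_def)

lemma ray_disjoint:
  assumes "v ^ 3 = 1" "w ^ 3 = 1" "z \<in> ray v" "z \<in> ray w"
  shows "v = w"
proof (rule ccontr)
  assume "v \<noteq> w"
  from assms obtain r where "r > 0" "z = r *\<^sub>R v" by (auto simp: ray_eq)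
  then have "inner w z < 0"
    using inner_distinct_cube_roots[OF assms(1,2) \<open>v \<noteq> w\<close>] by (simp add: mult_pos_neg)
  then show False using assms(4) by (simp add: ray_def)
qed

lemma inner_other_ray: "\<lbrakk>v ^ 3 = 1; w ^ 3 = 1; v \<noteq> w; z \<in> ray v\<rbrakk> \<Longrightarrow> inner w z \<le> 0"
  using ray_disjoint by (fastforce simp: ray_def not_le)

text \<open>On the triod, a cube root \<open>w\<close> and a height \<open>s >= 0\<close> determine
  at most one point with \<open>inner w z = s\<close>. The lemma therefore forces connected subsets
  of the triod through the centre or through a prescribed point of a branch.\<close>

lemma connected_inner_ivt:
  fixes S :: "complex set"
  assumes "connected S" "x \<in> S" "y \<in> S" "inner w x \<le> s" "s \<le> inner w y"
  shows "\<exists>z\<in>S. inner w z = s"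
proof -
  have "connected (inner w ` S)"
    by (intro connected_continuous_image continuous_intros assms)
  then have "s \<in> inner w ` S"
    using assms connectedD_interval[of "inner w ` S" "inner w x" "inner w y" s] by auto
  then show ?thesis by auto
qed

text \<open>A connected subset of the triod that meets \<open>ray w\<close> and leaves it contains a
  point with \<open>inner w z = 0\<close>, which is the removed centre. Conversely
  \<open>ray w\<close> is itself connected.\<close>

lemma connected_component_triod:
  assumes "w ^ 3 = 1" "x \<in> ray w"
  shows "connected_component_set (triod - {0}) x = ray w"
proof (intro subset_antisym subsetI)
  fix y assume y: "y \<in> connected_component_set (triod - {0}) x"
  let ?C = "connected_component_set (triod - {0}) x"
  have sub: "?C \<subseteq> triod - {0}" by (rule connected_component_subset)
  show "y \<in> ray w"
  proof (rule ccontr)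
    assume "y \<notin> ray w"
    then have "inner w y \<le> 0" using y sub by (auto simp: ray_def)
    moreover have "x \<in> ?C"
      using assms by (auto simp: ray_def intro!: connected_component_refl)
    moreover have "0 \<le> inner w x" using assms(2) by (simp add: ray_def)
    ultimately obtain z where "z \<in> ?C" "inner w z = 0"
      using connected_inner_ivt[of ?C y x w 0] y by auto
    then show False using triod_inner_nonneg[of z w] assms(1) sub by auto
  qed
next
  fix y assume "y \<in> ray w"
  have "connected (ray w)"
    unfolding ray_eq[OF assms(1)]
    by (intro connected_continuous_image continuous_intros connected_Ioc)
  then have "ray w \<subseteq> connected_component_set (triod - {0}) x"
    using assms by (intro connected_component_maximal) (auto simp: ray_def)
  then show "y \<in> connected_component_set (triod - {0}) x"
    using \<open>y \<in> ray w\<close> by blast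
qed

lemma branches_eq: "branches = ray ` {w. w ^ 3 = 1}"
proof (intro subset_antisym subsetI)
  fix B assume "B \<in> branches"
  then obtain x where "x \<in> triod - {0}" "B = connected_component_set (triod - {0}) x"
    by (auto simp: branches_def components_def)
  then show "B \<in> ray ` {w. w ^ 3 = 1}"
    unfolding triod_minus_zero_cover using connected_component_triod
    by (auto simp: triod_minus_zero_cover)
next
  fix B assume "B \<in> ray ` {w. w ^ 3 = 1}"
  then obtain w where w: "w ^ 3 = 1" "B = ray w" by auto
  then have "w \<in> ray w" by (auto simp: ray_eq intro!: image_eqI[of _ _ 1])
  then show "B \<in> branches"
    using connected_component_triod[OF w(1)] w(2) triod_minus_zero_cover w(1)
    by (auto simp: branches_def components_def intro!: image_eqI[of _ _ w])
qed

section \<open>Cycles and their hulls\<close>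

text \<open>The union of the segments from the centre to the points of \<open>P\<close>: an explicit
  model of the hull, justified in \<open>cycle_hull\<close>.\<close>

definition star :: "complex set \<Rightarrow> complex set" where
  "star P = (\<lambda>(t, p). t *\<^sub>R p) ` ({0..1} \<times> P)"

text \<open>Applying \<open>f\<close> shifts the indices 0, ..., n - 1 to 1, ..., n, and the two
  ends that are exchanged both give \<open>x\<close>.\<close>

lemma orbit_returns:
  assumes "(f ^^ n) x = x" "n > 0"
  shows "f ` ((\<lambda>i. (f ^^ i) x) ` {..<n}) = (\<lambda>i. (f ^^ i) x) ` {..<n}"
proof -
  have "{..<n} = insert 0 (Suc ` {..<n - 1})"
    using assms(2) by (cases n) (auto simp: lessThan_Suc_eq_insert_0)
  moreover have "Suc ` {..<n} = insert n (Suc ` {..<n - 1})"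
    using assms(2) by (cases n) (auto simp: lessThan_Suc)
  moreover have "f ` ((\<lambda>i. (f ^^ i) x) ` {..<n}) = (\<lambda>i. (f ^^ i) x) ` (Suc ` {..<n})"
    by (simp add: image_image)
  ultimately show ?thesis using assms(1) by (simp only: image_insert funpow_0)
qed

lemma cycle_map: "(f, P) \<in> cycles \<Longrightarrow> f \<in> triod_maps"
  by (simp add: cycles_def)

lemma cycle_image:
  assumes "(f, P) \<in> cycles"
  shows "f ` P = P"
proof -
  obtain x n where "n > 0" "(f ^^ n) x = x" "P = (\<lambda>i. (f ^^ i) x) ` {..<n}"
    using assms unfolding cycles_def periodic_orbit_def by blast
  then show ?thesis using orbit_returns[of n f x] by simp
qed

lemma cycle_finite: "(f, P) \<in> cycles \<Longrightarrow> finite P"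
  by (auto simp: cycles_def periodic_orbit_def)

lemma cycle_nonempty: "(f, P) \<in> cycles \<Longrightarrow> P \<noteq> {}"
  by (auto simp: cycles_def periodic_orbit_def)

lemma triod_maps_simps:
  assumes "f \<in> triod_maps"
  shows "f 0 = 0" "z \<in> triod \<Longrightarrow> f z \<in> triod" "z \<in> triod \<Longrightarrow> f z = z \<Longrightarrow> z = 0"
    "continuous_on triod f"
  using assms zero_in_triod by (auto simp: triod_maps_def)

lemma funpow_triod: "f \<in> triod_maps \<Longrightarrow> x \<in> triod \<Longrightarrow> (f ^^ i) x \<in> triod"
  by (induction i) (auto simp: triod_maps_simps)

text \<open>The centre is fixed, so an orbit that reaches it stays there; returning to its start, it
  would be \<open>{0}\<close>.\<close>

lemma cycle_subset:
  assumes "(f, P) \<in> cycles"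
  shows "P \<subseteq> triod - {0}"
proof -
  have f: "f \<in> triod_maps" using assms by (rule cycle_map)
  obtain x n where x: "x \<in> triod" "n > 0" "(f ^^ n) x = x" and P: "P = (\<lambda>i. (f ^^ i) x) ` {..<n}"
    using assms by (auto simp: cycles_def periodic_orbit_def)
  have "P \<noteq> {0}" using assms by (simp add: cycles_def)
  have f0: "(f ^^ k) 0 = 0" for k by (induction k) (auto simp: triod_maps_simps[OF f])
  have "(f ^^ i) x \<noteq> 0" if "i < n" for i
  proof
    assume "(f ^^ i) x = 0"
    then have "(f ^^ (n - i + i)) x = 0"
      unfolding funpow_add using f0 by simp
    with that x have "x = 0" by simp
    then have "P = {0}" using P x f0 by auto
    with \<open>P \<noteq> {0}\<close> show False by simp
  qed
  then show ?thesis using P funpow_triod[OF f x(1)] by auto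
qed

lemma continuous_on_ray_coordinate:
  assumes "f \<in> triod_maps" "w ^ 3 = 1"
  shows "continuous_on {0..1} (\<lambda>t. inner v (f (t *\<^sub>R w)))"
  by (intro continuous_intros continuous_on_compose2[OF triod_maps_simps(4)[OF assms(1)]])
    (auto simp: scaleR_in_triod assms)

text \<open>The extreme points of a cycle on a single branch would enclose a fixed point.\<close>

lemma cycle_not_in_ray:
  assumes "(f, P) \<in> cycles" "w ^ 3 = 1"
  shows "\<exists>q\<in>P. q \<notin> ray w"
proof (rule ccontr)
  assume "\<not> (\<exists>q\<in>P. q \<notin> ray w)"
  then have ray: "p \<in> ray w" if "p \<in> P" for p using that by blast
  have f: "f \<in> triod_maps" using assms(1) by (rule cycle_map)
  have fin: "finite (inner w ` P)" "inner w ` P \<noteq> {}"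
    using cycle_finite cycle_nonempty assms by auto
  obtain x where x: "x \<in> P" "inner w x = Min (inner w ` P)"
    using Min_in[OF fin] by (metis imageE)
  obtain y where y: "y \<in> P" "inner w y = Max (inner w ` P)"
    using Max_in[OF fin] by (metis imageE)
  \<comment> \<open>The displacement along the branch: nonnegative at the innermost point of the
    cycle and nonpositive at the outermost.\<close>
  define g where "g t = inner w (f (t *\<^sub>R w)) - t" for t
  have eq: "p = inner w p *\<^sub>R w" "0 < inner w p" "inner w p \<le> 1" if "p \<in> P" for p
    using ray[OF that] triod_inner_nonneg assms(2) triod_inner_le_one by (auto simp: ray_def)
  have "f x \<in> P" "f y \<in> P" using cycle_image[OF assms(1)] x y by auto
  then have "inner w x \<le> inner w (f x)" "inner w (f y) \<le> inner w y"
    unfolding x(2) y(2) using fin(1) by auto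
  then have "g (inner w x) \<ge> 0" "g (inner w y) \<le> 0"
    using eq(1)[OF x(1)] eq(1)[OF y(1)] by (simp_all add: g_def)
  moreover have "inner w x \<le> inner w y" using x y fin by auto
  moreover have "continuous_on {inner w x..inner w y} g"
  proof (rule continuous_on_subset)
    show "continuous_on {0..1} g"
      unfolding g_def
      by (intro continuous_on_diff continuous_on_id continuous_on_ray_coordinate f assms)
    show "{inner w x..inner w y} \<subseteq> {0..1}" using eq(2)[OF x(1)] eq(3)[OF y(1)] by auto
  qed
  ultimately obtain t where t: "inner w x \<le> t" "t \<le> inner w y" "g t = 0"
    using IVT2'[of g "inner w y" 0 "inner w x"] by auto
  then have "0 < t" "t \<le> 1" using eq[OF x(1)] eq[OF y(1)] by auto
  then have T: "t *\<^sub>R w \<in> triod" using assms by (intro scaleR_in_triod) auto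
  \<comment> \<open>Equality of the coordinates is enough: \<open>t > 0\<close> puts the image on
    \<open>ray w\<close>, where the coordinate determines the point.\<close>
  have "f (t *\<^sub>R w) = t *\<^sub>R w"
    using triod_inner_nonneg[OF triod_maps_simps(2)[OF f T] assms(2)] t \<open>0 < t\<close>
    by (simp add: g_def)
  then have "t *\<^sub>R w = 0" using triod_maps_simps(3)[OF f T] by simp
  then show False using \<open>0 < t\<close> assms(2) by auto
qed

section \<open>The hull of a cycle as a star\<close>

lemma star_subset_triod: "P \<subseteq> triod \<Longrightarrow> star P \<subseteq> triod"
proof (clarsimp simp: star_def)
  fix t :: real and p assume "P \<subseteq> triod" "p \<in> P" "0 \<le> t" "t \<le> 1"
  then have "p \<in> triod" by auto
  with \<open>0 \<le> t\<close> obtain r w where "w ^ 3 = 1" "0 \<le> r" "r \<le> 1" "p = r *\<^sub>R w" by (auto simp: triod_iff)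
  then show "t *\<^sub>R p \<in> triod"
    using scaleR_in_triod[of w "t * r"] \<open>0 \<le> t\<close> \<open>t \<le> 1\<close> by (simp add: mult_le_one)
qed

lemma subset_star: "P \<subseteq> star P"
  by (auto simp: star_def intro!: image_eqI[of _ _ "(1, _)"])

lemma connected_star: "connected (star P)"
proof -
  have "star P = (\<Union>p\<in>P. closed_segment 0 p)"
    by (force simp: star_def closed_segment_def)
  moreover have "connected \<dots>"
  proof (cases "P = {}")
    case False
    have "0 \<in> \<Inter> (closed_segment 0 ` P)" by auto
    then show ?thesis by (intro connected_Union) auto
  qed simp
  ultimately show ?thesis by simp
qed

text \<open>A connected subset of the triod containing \<open>P\<close> has, besides a point
  \<open>p\<close> on a branch, a point off that branch by \<open>cycle_not_in_ray\<close>;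
  intermediate values of the coordinate supply all points between the centre and
  \<open>p\<close>.\<close>

lemma cycle_hull:
  assumes "(f, P) \<in> cycles"
  shows "triod_hull P = star P"
proof (intro subset_antisym)
  show "triod_hull P \<subseteq> star P"
    unfolding triod_hull_def
    using cycle_subset[OF assms] star_subset_triod[of P] connected_star subset_star
    by (intro hull_minimal) auto
  show "star P \<subseteq> triod_hull P"
  proof
    fix z assume "z \<in> star P"
    then obtain t p where p: "p \<in> P" "0 \<le> t" "t \<le> 1" "z = t *\<^sub>R p" by (auto simp: star_def)
    then have "p \<in> triod" using cycle_subset[OF assms] by auto
    then obtain r w where w: "w ^ 3 = 1" "0 \<le> r" "r \<le> 1" "p = r *\<^sub>R w"
      by (auto simp: triod_iff)
    obtain q where q: "q \<in> P" "q \<notin> ray w" using cycle_not_in_ray[OF assms w(1)] by auto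
    then have q0: "inner w q \<le> 0" using cycle_subset[OF assms] by (auto simp: ray_def)
    have "z \<in> S" if S: "S \<subseteq> triod" "connected S" "P \<subseteq> S" for S
    proof -
      have "\<exists>y\<in>S. inner w y = t * r"
      proof (rule connected_inner_ivt)
        show "inner w q \<le> t * r" using q0 p w by (meson mult_nonneg_nonneg order_trans)
        show "t * r \<le> inner w p"
          using w p inner_cube_root_self by (simp add: mult_left_le_one_le)
      qed (use S p q in auto)
      then obtain y where y: "y \<in> S" "inner w y = t * r" by auto
      then have "y = z"
        using triod_inner_nonneg[of y w] S p w by auto
      then show ?thesis using y by simp
    qed
    then show "z \<in> triod_hull P" by (auto simp: triod_hull_def hull_def)
  qed
qed

section \<open>Equivalence of cycles\<close>

lemma cycle_equivI:
  assumes "(f, P) \<in> cycles" "(g, Q) \<in> cycles" "homeomorphism (star P) (star Q) h h'"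
    "h ` P = Q" "\<And>x. x \<in> P \<Longrightarrow> h (f x) = g (h x)"
    "\<And>w x. w ^ 3 = 1 \<Longrightarrow> x \<in> star P \<Longrightarrow> x \<in> ray w \<Longrightarrow> h x \<in> ray w"
  shows "((f, P), (g, Q)) \<in> cycle_equiv"
  using assms unfolding cycle_equiv_def by (auto simp: cycle_hull branches_eq)

lemma cycle_equivE:
  assumes "((f, P), (g, Q)) \<in> cycle_equiv"
  obtains h h' where "(f, P) \<in> cycles" "(g, Q) \<in> cycles" "homeomorphism (star P) (star Q) h h'"
    "h ` P = Q" "\<And>x. x \<in> P \<Longrightarrow> h (f x) = g (h x)"
    "\<And>w x. w ^ 3 = 1 \<Longrightarrow> x \<in> star P \<Longrightarrow> x \<in> ray w \<Longrightarrow> h x \<in> ray w"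
proof -
  have c: "(f, P) \<in> cycles" "(g, Q) \<in> cycles" using assms by (auto simp: cycle_equiv_def)
  obtain h h' where h: "homeomorphism (triod_hull P) (triod_hull Q) h h'"
    "h ` P = Q" "\<forall>x\<in>P. h (f x) = g (h x)" "\<forall>B\<in>branches. h ` (triod_hull P \<inter> B) \<subseteq> B"
    using assms by (auto simp: cycle_equiv_def)
  show ?thesis
  proof (rule that[OF c])
    show "homeomorphism (star P) (star Q) h h'" using h c by (simp add: cycle_hull)
    show "h x \<in> ray w" if "w ^ 3 = 1" "x \<in> star P" "x \<in> ray w" for w x
      using h(4) that c by (auto simp: cycle_hull branches_eq)
  qed (use h in auto)
qed

lemma ray_scaleR:
  assumes "z \<in> ray w" "0 < t" "t \<le> 1" "w ^ 3 = 1"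
  shows "t *\<^sub>R z \<in> ray w"
proof -
  obtain r where "0 < r" "r \<le> 1" "z = r *\<^sub>R w" using assms by (auto simp: ray_eq)
  then show ?thesis using assms by (auto simp: ray_eq mult_le_one intro!: image_eqI[of _ _ "t * r"])
qed

text \<open>The centre is a limit of points on two different branches, so it cannot move.\<close>

lemma branch_preserving_zero:
  assumes P: "(f, P) \<in> cycles"
    and cont: "continuous_on (star P) h" and triod: "h ` star P \<subseteq> triod"
    and br: "\<And>w x. w ^ 3 = 1 \<Longrightarrow> x \<in> star P \<Longrightarrow> x \<in> ray w \<Longrightarrow> h x \<in> ray w"
  shows "h 0 = 0"
proof (rule ccontr)
  assume "h 0 \<noteq> 0"
  have "0 \<in> star P" using cycle_nonempty[OF P] by (force simp: star_def)
  then have "h 0 \<in> triod - {0}" using triod \<open>h 0 \<noteq> 0\<close> by auto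
  then obtain w where w: "w ^ 3 = 1" "h 0 \<in> ray w" by (auto simp: triod_minus_zero_cover)
  obtain q where q: "q \<in> P" "q \<notin> ray w" using cycle_not_in_ray[OF P w(1)] by auto
  then have "q \<in> triod - {0}" using cycle_subset[OF P] by auto
  then obtain v where v: "v ^ 3 = 1" "q \<in> ray v" by (auto simp: triod_minus_zero_cover)
  then have "v \<noteq> w" using q by auto
  \<comment> \<open>The segment towards \<open>q\<close> lies on a branch other than
    \<open>ray w\<close>, and \<open>h\<close> keeps it there; letting \<open>t\<close> tend to 0
    contradicts \<open>h 0\<close> being on \<open>ray w\<close>.\<close>
  have le: "inner w (h (t *\<^sub>R q)) \<le> 0" if "t \<in> {0<..<1}" for t
    using that q v w \<open>v \<noteq> w\<close>
    by (intro inner_other_ray[of v] br ray_scaleR) (auto simp: star_def)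
  have "continuous_on {0..1} (\<lambda>t. inner w (h (t *\<^sub>R q)))"
    by (intro continuous_intros continuous_on_compose2[OF cont]) (use q in \<open>auto simp: star_def\<close>)
  then have "inner w (h (0 *\<^sub>R q)) \<le> 0"
    by (intro continuous_le_on_closure[of "{0<..<1::real}" "\<lambda>t. inner w (h (t *\<^sub>R q))" 0 0])
      (use le in auto)
  then show False using w(2) by (simp add: ray_def)
qed

lemma cycle_equiv_refl: "c \<in> cycles \<Longrightarrow> (c, c) \<in> cycle_equiv"
  by (cases c) (auto intro: cycle_equivI[where h = "\<lambda>x. x" and h' = "\<lambda>x. x"]
      simp: homeomorphism_def)

text \<open>The delicate condition is branch preservation by the inverse. As \<open>h 0 = 0\<close>,
  a point \<open>y\<close> off the centre has \<open>h' y\<close> on some branch; \<open>h\<close>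
  preserves that branch, so it is the branch of \<open>y\<close>.\<close>

lemma cycle_equiv_sym:
  assumes "(c, d) \<in> cycle_equiv"
  shows "(d, c) \<in> cycle_equiv"
proof -
  obtain f P g Q where cd: "c = (f, P)" "d = (g, Q)" by (cases c, cases d)
  obtain h h' where C: "(f, P) \<in> cycles" "(g, Q) \<in> cycles"
    and hom: "homeomorphism (star P) (star Q) h h'"
    and PQ: "h ` P = Q" and conj: "\<And>x. x \<in> P \<Longrightarrow> h (f x) = g (h x)"
    and br: "\<And>w x. w ^ 3 = 1 \<Longrightarrow> x \<in> star P \<Longrightarrow> x \<in> ray w \<Longrightarrow> h x \<in> ray w"
    using cycle_equivE[OF assms[unfolded cd]] by metis
  note H = homeomorphism_apply1[OF hom] homeomorphism_apply2[OF hom]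
    homeomorphism_image1[OF hom] homeomorphism_image2[OF hom] homeomorphism_cont1[OF hom]
  have tri: "star P \<subseteq> triod" "star Q \<subseteq> triod"
    using C cycle_subset star_subset_triod by blast+
  have h0: "h 0 = 0"
    using branch_preserving_zero[OF C(1) H(5)] H(3) tri br by auto
  have inv: "h' (h x) = x" if "x \<in> P" for x
    using H(1) subset_star that by blast
  show ?thesis unfolding cd
  proof (rule cycle_equivI[OF C(2,1)])
    show "homeomorphism (star Q) (star P) h' h" using hom by (rule homeomorphism_symD)
    show "h' ` Q = P" using inv PQ by force
    show "h' (g y) = f (h' y)" if y: "y \<in> Q" for y
    proof -
      obtain x where x: "x \<in> P" "y = h x" using y PQ by auto
      then have "f x \<in> P" using cycle_image[OF C(1)] by auto
      then show ?thesis using x inv[of x] inv[of "f x"] conj[of x] by simp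
    qed
    show "h' y \<in> ray w" if y: "w ^ 3 = 1" "y \<in> star Q" "y \<in> ray w" for w y
    proof -
      have in_P: "h' y \<in> star P" and eq: "h (h' y) = y" using H y by auto
      have "y \<noteq> 0" using y by (auto simp: ray_def)
      then have "h' y \<in> triod - {0}" using in_P tri eq h0 by auto
      then obtain v where "v ^ 3 = 1" "h' y \<in> ray v" by (auto simp: triod_minus_zero_cover)
      then show ?thesis using br[of v "h' y"] in_P eq y ray_disjoint[of v w y] by auto
    qed
  qed
qed

lemma cycle_equiv_trans:
  assumes "(c, d) \<in> cycle_equiv" "(d, e) \<in> cycle_equiv"
  shows "(c, e) \<in> cycle_equiv"
proof -
  obtain f P g Q k R where cde: "c = (f, P)" "d = (g, Q)" "e = (k, R)" by (cases c, cases d, cases e)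
  obtain h h' where C: "(f, P) \<in> cycles" "(g, Q) \<in> cycles"
    and h: "homeomorphism (star P) (star Q) h h'" "h ` P = Q"
    "\<And>x. x \<in> P \<Longrightarrow> h (f x) = g (h x)"
    "\<And>w x. w ^ 3 = 1 \<Longrightarrow> x \<in> star P \<Longrightarrow> x \<in> ray w \<Longrightarrow> h x \<in> ray w"
    using cycle_equivE[OF assms(1)[unfolded cde]] by metis
  obtain j j' where D: "(k, R) \<in> cycles"
    and j: "homeomorphism (star Q) (star R) j j'" "j ` Q = R"
    "\<And>x. x \<in> Q \<Longrightarrow> j (g x) = k (j x)"
    "\<And>w x. w ^ 3 = 1 \<Longrightarrow> x \<in> star Q \<Longrightarrow> x \<in> ray w \<Longrightarrow> j x \<in> ray w"
    using cycle_equivE[OF assms(2)[unfolded cde]] by metis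
  show ?thesis unfolding cde
  proof (rule cycle_equivI[OF C(1) D])
    show "homeomorphism (star P) (star R) (j \<circ> h) (h' \<circ> j')"
      using h(1) j(1) by (rule homeomorphism_compose)
    show "(j \<circ> h) (f x) = k ((j \<circ> h) x)" if "x \<in> P" for x using h(2,3) j(3) that by auto
    show "(j \<circ> h) x \<in> ray w" if "w ^ 3 = 1" "x \<in> star P" "x \<in> ray w" for w x
      using that h(4)[of w x] j(4)[of w "h x"] homeomorphism_image1[OF h(1)] by auto
    show "(j \<circ> h) ` P = R" using h(2) j(2) by (auto simp: image_comp)
  qed
qed

lemma equiv_cycle_equiv: "equiv cycles cycle_equiv"
proof (rule equivI)
  show "cycle_equiv \<subseteq> cycles \<times> cycles" by (auto simp: cycle_equiv_def)
  show "refl_on cycles cycle_equiv" by (intro refl_onI cycle_equiv_refl)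
  show "sym cycle_equiv" using cycle_equiv_sym by (auto intro: symI)
  show "trans cycle_equiv" using cycle_equiv_trans by (auto intro: transI)
qed

lemma pattern_eq_class: "A \<in> patterns \<Longrightarrow> c \<in> A \<Longrightarrow> A = cycle_equiv `` {c}"
  unfolding patterns_def by (metis Image_singleton_iff equiv_class_eq equiv_cycle_equiv quotientE)

section \<open>Three-cycles that rotate the branches\<close>

text \<open>Primitive three-cycles that advance the numbering, with points indexed by their branches
  so that the dynamics becomes addition modulo 3.\<close>

definition rotating_orbit ::
  "(nat \<Rightarrow> complex set) \<Rightarrow> (complex \<Rightarrow> complex) \<Rightarrow> complex set \<Rightarrow> (nat \<Rightarrow> complex) \<Rightarrow> bool" where
  "rotating_orbit b f P p \<longleftrightarrow> f \<in> triod_maps \<and> P = p ` {..<3} \<and>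
     (\<forall>i<3. p i \<in> b i \<and> f (p i) = p ((i + 1) mod 3))"

lemma less_3_cases: "(i::nat) < 3 \<longleftrightarrow> i = 0 \<or> i = 1 \<or> i = 2"
  by auto

lemma mod_3_less: "i mod 3 < (3::nat)"
  by simp

lemma branch_numbering_ray:
  assumes "branch_numbering b"
  obtains w where "\<And>i. i < 3 \<Longrightarrow> b i = ray (w i)" "\<And>i. i < 3 \<Longrightarrow> w i ^ 3 = 1"
    "inj_on w {..<3}" "{z. z ^ 3 = 1} = w ` {..<3}"
proof -
  have b: "inj_on b {..<3}" "b ` {..<3} = ray ` {z. z ^ 3 = 1}"
    using assms by (auto simp: branch_numbering_def bij_betw_def branches_eq)
  then have "\<forall>i\<in>{..<3}. \<exists>v. v ^ 3 = 1 \<and> b i = ray v" by blast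
  then obtain w where w: "\<And>i. i < 3 \<Longrightarrow> b i = ray (w i) \<and> w i ^ 3 = 1" by (metis lessThan_iff)
  have "inj_on w {..<3}"
    using b(1) w by (metis inj_on_def lessThan_iff)
  moreover have "{z. z ^ 3 = 1} = w ` {..<3}"
  proof (intro subset_antisym subsetI)
    fix v :: complex assume "v \<in> {z. z ^ 3 = 1}"
    then have v: "v ^ 3 = 1" by simp
    then have "ray v \<in> b ` {..<3}" using b(2) by blast
    then obtain i where i: "i < 3" "ray v = ray (w i)" using w by auto
    have "v \<in> ray v" using v by (auto simp: ray_eq intro!: image_eqI[of _ _ 1])
    then have "v = w i" using ray_disjoint[of v "w i" v] w i v by simp
    then show "v \<in> w ` {..<3}" using i by auto
  qed (use w in auto)
  ultimately show ?thesis using that w by blast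
qed

text \<open>Directions \<open>w i\<close> are fixed along with the numbering, since the computations
  use cube roots; \<open>branch_numbering_ray\<close> supplies them for every numbering.\<close>

locale numbered_triod =
  fixes b :: "nat \<Rightarrow> complex set" and w :: "nat \<Rightarrow> complex"
  assumes b_eq: "i < 3 \<Longrightarrow> b i = ray (w i)"
    and root: "i < 3 \<Longrightarrow> w i ^ 3 = 1"
    and inj: "inj_on w {..<3}"
    and roots: "{z. z ^ 3 = 1} = w ` {..<3}"
begin

lemma w_eq_iff: "i < 3 \<Longrightarrow> j < 3 \<Longrightarrow> w i = w j \<longleftrightarrow> i = j"
  using inj by (auto simp: inj_on_def)

lemma branch_unique: "i < 3 \<Longrightarrow> j < 3 \<Longrightarrow> z \<in> b i \<Longrightarrow> z \<in> b j \<Longrightarrow> i = j"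
  using ray_disjoint[of "w i" "w j" z] root b_eq w_eq_iff by auto

lemma branch_subset: "i < 3 \<Longrightarrow> b i \<subseteq> triod - {0}"
  using b_eq by (auto simp: ray_def)

lemma in_some_branch: "z \<in> triod - {0} \<Longrightarrow> \<exists>i<3. z \<in> b i"
  unfolding triod_minus_zero_cover roots using b_eq by auto

lemma branches_b: "branches = b ` {..<3}"
  unfolding branches_eq roots using b_eq by (auto simp: image_iff)

lemma branch_eq: "i < 3 \<Longrightarrow> z \<in> b i \<Longrightarrow> z = inner (w i) z *\<^sub>R w i"
  using triod_inner_nonneg[of z "w i"] root b_eq by (auto simp: ray_def)

lemma branch_index_eq: "i < 3 \<Longrightarrow> z \<in> b i \<Longrightarrow> branch_index b z = i"
  unfolding branch_index_def using branch_unique by blast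

lemma branch_dist_next:
  assumes "i < 3" "x \<in> b i" "y \<in> b ((i + 1) mod 3)"
  shows "branch_dist b x y = 1 / 3"
proof -
  have "branch_index b x = i" "branch_index b y = (i + 1) mod 3"
    using assms by (auto intro!: branch_index_eq)
  then show ?thesis
    using assms(1) unfolding less_3_cases by (auto simp: branch_dist_def)
qed

lemma branch_dist_next_iff:
  assumes "i < 3" "x \<in> b i" "y \<in> triod - {0}" "branch_dist b x y = 1 / 3"
  shows "y \<in> b ((i + 1) mod 3)"
proof -
  obtain j where j: "j < 3" "y \<in> b j" using in_some_branch assms by blast
  have "branch_index b x = i" "branch_index b y = j"
    using assms j by (auto intro!: branch_index_eq)
  then have "j = (i + 1) mod 3"
    using assms j(1) unfolding less_3_cases by (auto simp: branch_dist_def)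
  then show ?thesis using j by simp
qed

section \<open>Basic properties of rotating orbits\<close>

lemma rotating_orbitD:
  assumes "rotating_orbit b f P p" "i < 3"
  shows "p i \<in> P" "p i \<in> b i" "f (p i) = p ((i + 1) mod 3)" "p i \<in> triod - {0}"
proof -
  show "p i \<in> P" "p i \<in> b i" "f (p i) = p ((i + 1) mod 3)"
    using assms by (auto simp: rotating_orbit_def)
  then show "p i \<in> triod - {0}" using branch_subset[OF assms(2)] by blast
qed

lemma rotating_orbit_funpow:
  assumes "rotating_orbit b f P p" "i < 3"
  shows "(f ^^ k) (p i) = p ((i + k) mod 3)"
proof (induction k)
  case 0
  then show ?case using assms by simp
next
  case (Suc k)
  then show ?case
    using rotating_orbitD(3)[OF assms(1) mod_3_less, of "i + k"] by (simp add: mod_simps)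
qed

lemma rotating_orbit_eq: "rotating_orbit b f P p \<Longrightarrow> P = p ` {..<3}"
  by (simp add: rotating_orbit_def)

lemma rotating_orbit_inj:
  assumes "rotating_orbit b f P p"
  shows "inj_on p {..<3}"
proof (rule inj_onI)
  fix i j assume "i \<in> {..<3::nat}" "j \<in> {..<3::nat}" "p i = p j"
  then show "i = j"
    using rotating_orbitD(2)[OF assms, of i] rotating_orbitD(2)[OF assms, of j] branch_unique by simp
qed

lemma rotating_orbit_card: "rotating_orbit b f P p \<Longrightarrow> card P = 3"
  using rotating_orbit_inj[of f P p] rotating_orbit_eq[of f P p] by (simp add: card_image)

lemma rotating_orbit_cycle:
  assumes "rotating_orbit b f P p"
  shows "(f, P) \<in> cycles"
proof -
  have p0: "p 0 \<in> triod - {0}" using rotating_orbitD(4)[OF assms] by simp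
  have "(\<lambda>i. (f ^^ i) (p 0)) ` {..<3} = p ` {..<3}"
    by (intro image_cong) (auto simp: rotating_orbit_funpow[OF assms])
  moreover have "(f ^^ 3) (p 0) = p 0"
    using rotating_orbit_funpow[OF assms, of 0 3] by simp
  ultimately have "periodic_orbit f P"
    unfolding periodic_orbit_def rotating_orbit_eq[OF assms] using p0
    by (intro bexI[of _ "p 0"] exI[of _ 3]) auto
  moreover have "P \<noteq> {0}"
    using p0 rotating_orbitD(1)[OF assms, of 0] by auto
  ultimately show ?thesis using assms by (auto simp: cycles_def rotating_orbit_def)
qed

lemma rotating_orbit_Int_branch:
  assumes "rotating_orbit b f P p" "i < 3"
  shows "P \<inter> b i = {p i}"
proof -
  have "x = p i" if x: "x \<in> P" "x \<in> b i" for x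
  proof -
    obtain j where j: "j < 3" "x = p j" using x rotating_orbit_eq[OF assms(1)] by auto
    then have "j = i" using rotating_orbitD(2)[OF assms(1) j(1)] x branch_unique assms by simp
    then show ?thesis using j by simp
  qed
  then show ?thesis using rotating_orbitD(1,2)[OF assms] by blast
qed

lemma rotating_orbit_primitive: "rotating_orbit b f P p \<Longrightarrow> primitive_cycle (f, P)"
  by (auto simp: primitive_cycle_def branches_b rotating_orbit_Int_branch)

text \<open>Advancing one point round the numbering shows that all three branches are met;
  primitivity leaves one point on each, so the image of the point on one branch is the point on the
  next.\<close>

lemma primitive_rotating_orbit:
  assumes "(f, P) \<in> cycles" "primitive_cycle (f, P)"
    and rot: "\<And>i x. i < 3 \<Longrightarrow> x \<in> P \<Longrightarrow> x \<in> b i \<Longrightarrow> f x \<in> b ((i + 1) mod 3)"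
  shows "\<exists>p. rotating_orbit b f P p"
proof -
  have step: "f x \<in> P \<inter> b ((i + 1) mod 3)" if "i < 3" "x \<in> P \<inter> b i" for i x
    using rot that cycle_image[OF assms(1)] by auto
  obtain x i where "i < 3" "x \<in> P \<inter> b i"
    using cycle_nonempty[OF assms(1)] cycle_subset[OF assms(1)] in_some_branch by blast
  then have *: "\<exists>y. y \<in> P \<inter> b ((i + k) mod 3)" for k
  proof (induction k)
    case (Suc k)
    then obtain y where "y \<in> P \<inter> b ((i + k) mod 3)" by auto
    then show ?case using step[OF mod_3_less, of y "i + k"] by (auto simp: mod_simps)
  qed auto
  have "\<exists>y. y \<in> P \<inter> b j" if "j < 3" for j
    \<comment> \<open>The summand 3 keeps the difference from being cut off at 0 in the
      naturals.\<close>
    using *[of "(j + 3) - i"] that \<open>i < 3\<close> by simp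
  then obtain p where p: "\<And>j. j < 3 \<Longrightarrow> p j \<in> P \<inter> b j" by metis
  have uniq: "x = p j" if "j < 3" "x \<in> P \<inter> b j" for x j
    using assms(2) p[OF that(1)] that unfolding primitive_cycle_def branches_b by auto
  have "P = p ` {..<3}"
  proof (intro subset_antisym subsetI)
    fix x assume "x \<in> P"
    then obtain j where "j < 3" "x \<in> b j"
      using cycle_subset[OF assms(1)] in_some_branch by blast
    then show "x \<in> p ` {..<3}" using uniq \<open>x \<in> P\<close> by auto
  qed (use p in auto)
  moreover have "f (p j) = p ((j + 1) mod 3)" if "j < 3" for j
    using uniq[OF mod_3_less] step[OF that p[OF that]] by blast
  ultimately have "rotating_orbit b f P p"
    using p cycle_map[OF assms(1)] by (auto simp: rotating_orbit_def)
  then show ?thesis by blast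
qed

text \<open>On the branch of index \<open>i\<close> the other summands are cut off by
  \<open>max 0\<close>, and what is left is the linear map taking \<open>p i\<close> to
  \<open>q i\<close>. A single formula avoids pasting continuous pieces.\<close>

definition stretch :: "(nat \<Rightarrow> complex) \<Rightarrow> (nat \<Rightarrow> complex) \<Rightarrow> complex \<Rightarrow> complex" where
  "stretch p q z = (\<Sum>i<3. (max 0 (inner (w i) z) / inner (w i) (p i)) *\<^sub>R q i)"

lemma stretch_apply:
  assumes p: "\<And>i. i < 3 \<Longrightarrow> p i \<in> b i" and "j < 3" "0 \<le> t"
  shows "stretch p q (t *\<^sub>R p j) = t *\<^sub>R q j"
proof -
  have "stretch p q (t *\<^sub>R p j) = (\<Sum>i<3. if i = j then t *\<^sub>R q j else 0)"
    unfolding stretch_def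
  proof (rule sum.cong)
    fix i :: nat assume "i \<in> {..<3}"
    then have i: "i < 3" by simp
    show "(max 0 (inner (w i) (t *\<^sub>R p j)) / inner (w i) (p i)) *\<^sub>R q i =
        (if i = j then t *\<^sub>R q j else 0)"
    proof (cases "i = j")
      case True
      have "0 < inner (w j) (p j)"
        using p[OF assms(2)] b_eq[OF assms(2)] by (simp add: ray_def)
      then show ?thesis using True assms(3) by simp
    next
      case False
      then have "inner (w i) (p j) \<le> 0"
        using inner_other_ray[of "w j" "w i" "p j"] p[OF assms(2)] b_eq root w_eq_iff i assms(2) by auto
      then have "max 0 (inner (w i) (t *\<^sub>R p j)) = 0"
        using assms(3) by (simp add: mult_nonneg_nonpos)
      then show ?thesis using False by simp
    qed
  qed simp
  also have "\<dots> = t *\<^sub>R q j" using assms(2) by simp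
  finally show ?thesis .
qed

lemma continuous_on_stretch: "continuous_on S (stretch p q)"
  unfolding stretch_def divide_inverse by (intro continuous_intros)

text \<open>The branchwise linear map \<open>stretch p q\<close> is the conjugating homeomorphism
  between the stars, with inverse \<open>stretch q p\<close>.\<close>

lemma rotating_orbits_equiv:
  assumes P: "rotating_orbit b f P p" and Q: "rotating_orbit b g Q q"
  shows "((f, P), (g, Q)) \<in> cycle_equiv"
proof (rule cycle_equivI)
  note pq = rotating_orbitD(2)[OF P] rotating_orbitD(2)[OF Q]
  note apply_p = stretch_apply[of p _ _ q, OF pq(1)]
  note apply_q = stretch_apply[of q _ _ p, OF pq(2)]
  have star_P: "star P = (\<lambda>(t, i). t *\<^sub>R p i) ` ({0..1} \<times> {..<3})"
    unfolding star_def rotating_orbit_eq[OF P] by (force simp: image_iff)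
  have star_Q: "star Q = (\<lambda>(t, i). t *\<^sub>R q i) ` ({0..1} \<times> {..<3})"
    unfolding star_def rotating_orbit_eq[OF Q] by (force simp: image_iff)
  have at_p: "stretch p q (p i) = q i" if "i < 3" for i
    using apply_p[OF _ that, of 1] by simp
  show "(f, P) \<in> cycles" "(g, Q) \<in> cycles"
    using P Q by (auto intro: rotating_orbit_cycle)
  show "homeomorphism (star P) (star Q) (stretch p q) (stretch q p)"
  proof (rule homeomorphismI)
    show "stretch p q ` star P \<subseteq> star Q" "stretch q p ` star Q \<subseteq> star P"
      unfolding star_P star_Q
      by (auto simp: apply_p apply_q intro!: image_eqI[of _ _ "(_, _)"])
    show "stretch q p (stretch p q x) = x" if "x \<in> star P" for x
      using that unfolding star_P by (auto simp: apply_p apply_q)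
    show "stretch p q (stretch q p x) = x" if "x \<in> star Q" for x
      using that unfolding star_Q by (auto simp: apply_p apply_q)
  qed (rule continuous_on_stretch)+
  show "stretch p q ` P = Q"
    unfolding rotating_orbit_eq[OF P] rotating_orbit_eq[OF Q] image_image
    using at_p by (auto intro!: image_cong)
  show "stretch p q (f x) = g (stretch p q x)" if "x \<in> P" for x
  proof -
    obtain i where i: "i < 3" "x = p i" using \<open>x \<in> P\<close> rotating_orbit_eq[OF P] by auto
    then show ?thesis
      using at_p[OF mod_3_less] by (simp add: at_p rotating_orbitD(3)[OF P] rotating_orbitD(3)[OF Q])
  qed
  show "stretch p q x \<in> ray v" if v: "v ^ 3 = 1" "x \<in> star P" "x \<in> ray v" for v x
  proof -
    obtain t i where t: "0 \<le> t" "t \<le> 1" "i < 3" "x = t *\<^sub>R p i" using v star_P by auto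
    have "t \<noteq> 0" using v(3) t by (auto simp: ray_def)
    then have "x \<in> ray (w i)" "t *\<^sub>R q i \<in> ray (w i)"
      using t pq b_eq root ray_scaleR by auto
    then show ?thesis
      using t ray_disjoint[of v "w i" x] v root apply_p by auto
  qed
qed

lemma pi3_eq_class:
  assumes P: "rotating_orbit b f P p"
  shows "pi3 b = cycle_equiv `` {(f, P)}"
  unfolding pi3_def
proof (rule the_equality)
  have "\<forall>i<3. \<forall>x\<in>P \<inter> b i. f x \<in> b ((i + 1) mod 3)"
    using rotating_orbit_Int_branch[OF P] rotating_orbitD(3)[OF P]
      rotating_orbitD(2)[OF P mod_3_less] by simp
  then show "\<exists>g Q. (g, Q) \<in> cycles \<and> cycle_equiv `` {(f, P)} = cycle_equiv `` {(g, Q)} \<and>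
     primitive_cycle (g, Q) \<and> card Q = 3 \<and> (\<forall>i<3. \<forall>x\<in>Q \<inter> b i. g x \<in> b ((i + 1) mod 3))"
    using rotating_orbit_cycle[OF P] rotating_orbit_primitive[OF P] rotating_orbit_card[OF P] by blast
next
  fix A
  assume "\<exists>g Q. (g, Q) \<in> cycles \<and> A = cycle_equiv `` {(g, Q)} \<and>
     primitive_cycle (g, Q) \<and> card Q = 3 \<and> (\<forall>i<3. \<forall>x\<in>Q \<inter> b i. g x \<in> b ((i + 1) mod 3))"
  then obtain g Q where gQ: "(g, Q) \<in> cycles" "A = cycle_equiv `` {(g, Q)}" "primitive_cycle (g, Q)"
    "\<forall>i<3. \<forall>x\<in>Q \<inter> b i. g x \<in> b ((i + 1) mod 3)" by blast
  then obtain q where "rotating_orbit b g Q q" using primitive_rotating_orbit[of g Q] by blast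
  then show "A = cycle_equiv `` {(f, P)}"
    using rotating_orbits_equiv P gQ(2) equiv_class_eq[OF equiv_cycle_equiv] by blast
qed

section \<open>Rotation number and canonicity of rotating orbits\<close>

lemma rotating_orbit_cycle_rotation_number:
  assumes "rotating_orbit b f P p"
  shows "cycle_rotation_number b (f, P) = 1 / 3"
proof -
  have "(\<Sum>i<3. branch_dist b ((f ^^ i) x) ((f ^^ Suc i) x)) = 1" if "x \<in> P" for x
  proof -
    obtain j where j: "j < 3" "x = p j" using \<open>x \<in> P\<close> rotating_orbit_eq[OF assms] by auto
    have "branch_dist b ((f ^^ i) x) ((f ^^ Suc i) x) = 1 / 3" for i
      unfolding j(2) rotating_orbit_funpow[OF assms j(1)]
      using rotating_orbitD(2)[OF assms mod_3_less, of "j + i"]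
        rotating_orbitD(2)[OF assms mod_3_less, of "j + Suc i"]
      by (intro branch_dist_next[OF mod_3_less]) (auto simp: mod_simps)
    then show ?thesis by (simp only: sum_constant) simp
  qed
  then have "(\<lambda>x. (\<Sum>i<card P. branch_dist b ((f ^^ i) x) ((f ^^ Suc i) x), card P)) ` P = {(1, 3)}"
    using rotating_orbit_cycle[OF assms, THEN cycle_nonempty] rotating_orbit_card[OF assms]
    by (force simp del: funpow.simps)
  then show ?thesis
    by (simp add: cycle_rotation_number_def rotation_pair_def del: funpow.simps)
qed

lemma rotating_orbit_canonical:
  assumes "rotating_orbit b f P p"
  shows "canonical_for_cycle b (f, P)"
proof -
  have "black b f (p i)" if "i < 3" for i
    using branch_dist_next[OF that rotating_orbitD(2)[OF assms that]] rotating_orbitD(3)[OF assms that]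
      rotating_orbitD(2)[OF assms mod_3_less]
    by (simp add: black_def)
  then show ?thesis
    by (auto simp: canonical_for_cycle_def rotating_orbit_Int_branch[OF assms])
qed

section \<open>Canonical cycles force a rotating three-cycle\<close>

text \<open>Three successive passages from branch to branch give a self-map \<open>G\<close> of the
  radial coordinate on \<open>b 0\<close>. It satisfies \<open>G y0 >= y0\<close> at some
  \<open>y0 > 0\<close> and \<open>G 1 <= 1\<close>; a fixed point between them starts the orbit
  sought.\<close>

lemma exists_rotating_orbit:
  assumes f: "f \<in> triod_maps" and p: "\<And>i. i < 3 \<Longrightarrow> p i \<in> b i"
    and above: "\<And>i. i < 3 \<Longrightarrow>
      inner (w ((i + 1) mod 3)) (p ((i + 1) mod 3)) \<le> inner (w ((i + 1) mod 3)) (f (p i))"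
  shows "\<exists>P q. rotating_orbit b f P q"
proof -
  \<comment> \<open>The radial coordinate of the image on the next branch, truncated to 0 when the
    image is elsewhere; a positive value thus certifies that the image is on that branch.\<close>
  define \<phi> where "\<phi> i t = max 0 (inner (w ((i + 1) mod 3)) (f (t *\<^sub>R w i)))" for i t
  define c where "c i = inner (w i) (p i)" for i
  have c: "0 < c i" "c i \<le> 1" "c i *\<^sub>R w i = p i" if "i < 3" for i
    using p[OF that] b_eq[OF that] branch_eq[OF that] triod_inner_le_one root[OF that]
    by (auto simp: c_def ray_def)
  have cont: "continuous_on {0..1} (\<phi> i)" if "i < 3" for i
    unfolding \<phi>_def by (intro continuous_intros continuous_on_ray_coordinate f root that)
  have tri: "f (t *\<^sub>R w i) \<in> triod" if "i < 3" "0 \<le> t" "t \<le> 1" for i t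
    using that by (intro triod_maps_simps(2)[OF f] scaleR_in_triod root)
  have range: "\<phi> i t \<in> {0..1}" if "i < 3" "t \<in> {0..1}" for i t
    using triod_inner_le_one[OF tri root[OF mod_3_less]] that by (auto simp: \<phi>_def)
  have zero: "\<phi> i 0 = 0" for i
    using triod_maps_simps(1)[OF f] by (simp add: \<phi>_def)
  have high: "c ((i + 1) mod 3) \<le> \<phi> i (c i)" if "i < 3" for i
    using above[OF that] c(3)[OF that] by (simp add: \<phi>_def c_def)
  \<comment> \<open>Each \<open>\<phi> i\<close> starts at 0 and reaches at least the height of the
    next point. Preimages are taken below \<open>c i\<close> because the preceding passage is only
    known to reach that height.\<close>
  have preimage: "\<exists>y. 0 \<le> y \<and> y \<le> c i \<and> \<phi> i y = s"
    if "i < 3" "0 \<le> s" "s \<le> c ((i + 1) mod 3)" for i s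
  proof (rule IVT')
    show "\<phi> i 0 \<le> s" using that zero by simp
    show "s \<le> \<phi> i (c i)" using high[OF that(1)] that by linarith
    show "0 \<le> c i" using c[OF that(1)] by simp
    show "continuous_on {0..c i} (\<phi> i)"
      using c[OF that(1)] by (intro continuous_on_subset[OF cont[OF that(1)]]) auto
  qed
  obtain y2 where y2: "0 \<le> y2" "y2 \<le> c 2" "\<phi> 2 y2 = c 0"
    using preimage[of 2 "c 0"] c[of 0] by auto
  obtain y1 where y1: "0 \<le> y1" "y1 \<le> c 1" "\<phi> 1 y1 = y2"
    using preimage[of 1 y2] y2 by (auto simp: numeral_2_eq_2)
  obtain y0 where y0: "0 \<le> y0" "y0 \<le> c 0" "\<phi> 0 y0 = y1"
    using preimage[of 0 y1] y1 by auto
  define G where "G t = \<phi> 2 (\<phi> 1 (\<phi> 0 t))" for t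
  have "G y0 = c 0" using y0 y1 y2 by (simp add: G_def)
  \<comment> \<open>\<open>G\<close> fixes 0, whereas \<open>G y0 = c 0\<close> is positive; this
    keeps the fixed point found below away from the centre.\<close>
  then have "y0 \<noteq> 0" using c(1)[of 0] zero by (auto simp: G_def)
  have "\<exists>z\<ge>y0. z \<le> 1 \<and> G z - z = 0"
  proof (rule IVT2')
    show "0 \<le> G y0 - y0" using y0 \<open>G y0 = c 0\<close> by simp
    show "G 1 - 1 \<le> 0"
      using range[of 2 "\<phi> 1 (\<phi> 0 1)"] range[of 1 "\<phi> 0 1"] range[of 0 1] by (simp add: G_def)
    show "y0 \<le> 1" using y0 c(2)[of 0] by simp
    have "continuous_on {0..1} G"
      unfolding G_def
      by (intro continuous_on_compose2[OF cont[of 2]] continuous_on_compose2[OF cont[of 1]] cont)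
        (use range in fastforce)+
    then show "continuous_on {y0..1} (\<lambda>z. G z - z)"
      using y0 by (intro continuous_intros) (auto elim: continuous_on_subset)
  qed
  then obtain z where z: "y0 \<le> z" "z \<le> 1" "G z = z" by auto
  \<comment> \<open>The successive heights of \<open>z\<close> under the passages; the third passage
    returns to \<open>z\<close> because \<open>G z = z\<close>.\<close>
  define r where "r i = (if i = 0 then z else if i = 1 then \<phi> 0 z else \<phi> 1 (\<phi> 0 z))" for i :: nat
  have r_next: "\<phi> i (r i) = r ((i + 1) mod 3)" if "i < 3" for i
    using that z(3) unfolding less_3_cases by (auto simp: r_def G_def)
  have "0 < z" using z y0 \<open>y0 \<noteq> 0\<close> by simp
  have r01: "r i \<in> {0..1}" if "i < 3" for i
    using that \<open>0 < z\<close> z(2) range[of 0 z] range[of 1 "\<phi> 0 z"] unfolding less_3_cases by (auto simp: r_def)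
  \<comment> \<open>A truncation to 0 along the way would propagate to \<open>G z = 0\<close>,
    contrary to \<open>G z = z > 0\<close>.\<close>
  have "\<phi> 1 (\<phi> 0 z) \<noteq> 0" using \<open>0 < z\<close> z(3) zero by (auto simp: G_def)
  moreover from this have "\<phi> 0 z \<noteq> 0" using zero by auto
  ultimately have "r i \<noteq> 0" for i using \<open>0 < z\<close> by (simp add: r_def)
  then have r: "0 < r i" "r i \<le> 1" if "i < 3" for i
    using r01[OF that] by (auto simp: less_le)
  have "f (r i *\<^sub>R w i) = r ((i + 1) mod 3) *\<^sub>R w ((i + 1) mod 3)" if "i < 3" for i
  proof -
    \<comment> \<open>The next height is positive, so the truncation was inactive and the image lies
      on the next branch.\<close>
    have "inner (w ((i + 1) mod 3)) (f (r i *\<^sub>R w i)) = r ((i + 1) mod 3)"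
      using r_next[OF that] r(1)[OF mod_3_less, of "i + 1"] by (auto simp: \<phi>_def max_def split: if_splits)
    then show ?thesis
      using triod_inner_nonneg[OF tri[OF that] root[OF mod_3_less], of "r i" "i + 1"] r[OF that]
        r(1)[OF mod_3_less, of "i + 1"] by simp
  qed
  moreover have "r i *\<^sub>R w i \<in> b i" if "i < 3" for i
    using r[OF that] b_eq[OF that] root[OF that] by (auto simp: ray_eq)
  ultimately have "rotating_orbit b f ((\<lambda>i. r i *\<^sub>R w i) ` {..<3}) (\<lambda>i. r i *\<^sub>R w i)"
    using f by (simp add: rotating_orbit_def)
  then show ?thesis by blast
qed

text \<open>A black point \<open>p i\<close> has its image on the next branch. The image belongs to
  \<open>P\<close>, so it is no closer to the centre than the innermost point of \<open>P\<close> on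
  that branch.\<close>

lemma canonical_cycle_rotating_orbit:
  assumes P: "(f, P) \<in> cycles" and "canonical_for_cycle b (f, P)"
  shows "\<exists>Q q. rotating_orbit b f Q q"
proof -
  obtain p where p: "\<And>i. i < 3 \<Longrightarrow> p i \<in> P \<inter> b i"
    "\<And>i y. i < 3 \<Longrightarrow> y \<in> P \<inter> b i \<Longrightarrow> dist 0 (p i) \<le> dist 0 y"
    "\<And>i. i < 3 \<Longrightarrow> black b f (p i)"
  proof -
    have "\<forall>i. \<exists>x. i < 3 \<longrightarrow> x \<in> P \<inter> b i \<and> (\<forall>y\<in>P \<inter> b i. dist 0 x \<le> dist 0 y) \<and> black b f x"
      using assms(2) unfolding canonical_for_cycle_def by blast
    from choice[OF this] obtain p where "\<forall>i. i < 3 \<longrightarrow>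
        p i \<in> P \<inter> b i \<and> (\<forall>y\<in>P \<inter> b i. dist 0 (p i) \<le> dist 0 y) \<and> black b f (p i)"
      by blast
    then show ?thesis by (intro that[of p]) auto
  qed
  have norm_eq: "norm z = inner (w i) z" if "i < 3" "z \<in> b i" for i z
  proof -
    have "norm z = norm (inner (w i) z *\<^sub>R w i)" using branch_eq[OF that] by simp
    also have "\<dots> = inner (w i) z"
      using that norm_cube_root_unity[OF root[OF that(1)]] b_eq by (simp add: ray_def)
    finally show ?thesis .
  qed
  show ?thesis
  proof (rule exists_rotating_orbit)
    show "f \<in> triod_maps" using P by (rule cycle_map)
    show "p i \<in> b i" if "i < 3" for i using p(1)[OF that] by simp
    show "inner (w ((i + 1) mod 3)) (p ((i + 1) mod 3)) \<le> inner (w ((i + 1) mod 3)) (f (p i))"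
      if i: "i < 3" for i
    proof -
      have "f (p i) \<in> P" using p(1)[OF i] cycle_image[OF P] by auto
      moreover have "f (p i) \<in> b ((i + 1) mod 3)"
        using branch_dist_next_iff[OF i, of "p i" "f (p i)"] p(1,3)[OF i] \<open>f (p i) \<in> P\<close> cycle_subset[OF P]
        by (auto simp: black_def)
      ultimately have "dist 0 (p ((i + 1) mod 3)) \<le> dist 0 (f (p i))"
        using p(2)[OF mod_3_less] by simp
      then show ?thesis
        using norm_eq[OF mod_3_less, of "p ((i + 1) mod 3)" "i + 1"] p(1)[OF mod_3_less, of "i + 1"]
          norm_eq[OF mod_3_less \<open>f (p i) \<in> b ((i + 1) mod 3)\<close>] by simp
    qed
  qed
qed

section \<open>The rotation of the triod\<close>

text \<open>The quotient \<open>c\<close> is a nontrivial cube root of unity. Then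
  \<open>c * w 1\<close> differs from \<open>w 1\<close>, and also from \<open>w 0\<close>, since
  \<open>c * c = 1\<close> and \<open>c ^ 3 = 1\<close> would give \<open>c = 1\<close>; hence it is
  \<open>w 2\<close>, and a third step returns to \<open>w 0\<close>.\<close>

lemma rotation_root:
  assumes "i < 3"
  shows "w 1 / w 0 * w i = w ((i + 1) mod 3)"
proof -
  define c where "c = w 1 / w 0"
  have nz: "w 0 \<noteq> 0" using root[of 0] by auto
  have c3: "c ^ 3 = 1" using root[of 0] root[of 1] by (simp add: c_def power_divide)
  have c0: "c * w 0 = w 1" using nz by (simp add: c_def)
  have "c \<noteq> 1" using c0 w_eq_iff[of 0 1] by auto
  have "(c * w 1) ^ 3 = 1" using c3 root[of 1] by (simp add: power_mult_distrib)
  then obtain j where j: "j < 3" "c * w 1 = w j" using roots by blast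
  have "j \<noteq> 1" using j \<open>c \<noteq> 1\<close> root[of 1] by auto
  moreover have "j \<noteq> 0"
  proof
    assume "j = 0"
    then have "c * c * w 0 = w 0" using j c0 by (simp add: mult.assoc)
    then have "c * c = 1" using nz by simp
    then show False using c3 \<open>c \<noteq> 1\<close> by (simp add: power3_eq_cube)
  qed
  ultimately have c1: "c * w 1 = w 2" using j unfolding less_3_cases by auto
  have "c * w 2 = c ^ 3 * w 0" using c0 c1 by (simp add: power3_eq_cube mult.assoc)
  then have "c * w 2 = w 0" using c3 by simp
  then show ?thesis
    using assms c0 c1 unfolding c_def[symmetric] less_3_cases by (auto simp: numeral_2_eq_2)
qed

text \<open>The rigid rotation in the sense of the numbering, clockwise or counterclockwise. It
  serves as the test map for forcing.\<close>

definition rotation :: "complex \<Rightarrow> complex" where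
  "rotation z = w 1 / w 0 * z"

lemma rotation_maps: "rotation \<in> triod_maps"
proof -
  have root': "(w 1 / w 0) ^ 3 = 1" using root[of 0] root[of 1] by (simp add: power_divide)
  have "rotation z \<in> triod" if "z \<in> triod" for z
    using that root' unfolding triod_def rotation_def mem_Collect_eq power_mult_distrib by simp
  moreover have "w 1 / w 0 \<noteq> 1"
    using w_eq_iff[of 0 1] root[of 0] by auto
  then have "rotation z = z \<longleftrightarrow> z = 0" for z
    unfolding rotation_def by (metis mult_cancel_right1 mult_zero_right mult.commute mult_cancel_left2)
  moreover have "continuous_on triod rotation"
    unfolding rotation_def by (intro continuous_intros)
  ultimately show ?thesis by (auto simp: triod_maps_def)
qed

lemma rotation_rotating_orbit:
  assumes "0 < r" "r \<le> 1"
  shows "rotating_orbit b rotation ((\<lambda>i. r *\<^sub>R w i) ` {..<3}) (\<lambda>i. r *\<^sub>R w i)"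
proof -
  have "r *\<^sub>R w i \<in> b i" if "i < 3" for i
    using assms b_eq[OF that] root[OF that] by (auto simp: ray_eq)
  moreover have "rotation (r *\<^sub>R w i) = r *\<^sub>R w ((i + 1) mod 3)" if "i < 3" for i
    unfolding rotation_root[OF that, symmetric] rotation_def by simp
  ultimately show ?thesis using rotation_maps by (simp add: rotating_orbit_def)
qed

text \<open>Such a cycle keeps the distance of its starting point from the centre, so it is
  contained in a rotating orbit; primitivity and the advance of branches pass to the subset.\<close>

lemma rotation_cycle:
  assumes P: "(rotation, P) \<in> cycles"
  shows "\<exists>p. rotating_orbit b rotation P p"
proof (rule primitive_rotating_orbit[OF P])
  obtain x n where x: "n > 0" "P = (\<lambda>i. (rotation ^^ i) x) ` {..<n}"
    using P by (auto simp: cycles_def periodic_orbit_def)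
  then have "x \<in> P" by (auto intro!: image_eqI[of _ _ 0])
  then have "x \<in> triod - {0}" using cycle_subset[OF P] by blast
  then obtain i where i: "i < 3" "x \<in> b i" using in_some_branch by blast
  define r where "r = inner (w i) x"
  have "0 < r" "r \<le> 1" "x = r *\<^sub>R w i"
    using i b_eq branch_eq triod_inner_le_one root by (auto simp: ray_def r_def)
  note orbit = rotation_rotating_orbit[OF this(1,2)]
  have sub: "P \<subseteq> (\<lambda>i. r *\<^sub>R w i) ` {..<3}" (is "P \<subseteq> ?R")
    unfolding x(2) \<open>x = r *\<^sub>R w i\<close> using rotating_orbit_funpow[OF orbit i(1)] by auto
  show "primitive_cycle (rotation, P)"
    unfolding primitive_cycle_def case_prod_conv
  proof (intro ballI)
    fix B x y assume "B \<in> branches" "x \<in> P \<inter> B" "y \<in> P \<inter> B"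
    moreover from this sub have "x \<in> ?R \<inter> B" "y \<in> ?R \<inter> B" by blast+
    ultimately show "x = y"
      using rotating_orbit_primitive[OF orbit] unfolding primitive_cycle_def case_prod_conv by metis
  qed
  show "rotation y \<in> b ((j + 1) mod 3)" if "j < 3" "y \<in> P" "y \<in> b j" for j y
  proof -
    have "y = r *\<^sub>R w j" using rotating_orbit_Int_branch[OF orbit that(1)] sub that(2,3) by blast
    then show ?thesis
      using rotating_orbitD(3)[OF orbit that(1)] rotating_orbitD(2)[OF orbit mod_3_less, of "j + 1"]
      by simp
  qed
qed

section \<open>The pattern of the primitive three-cycle\<close>

text \<open>An equivalence carries the orbit of end points under the rotation to the given cycle,
  preserving branches and dynamics, and so transports the indexing. Membership in the class becomes
  an explicit condition on the cycle.\<close>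

lemma mem_pi3_iff: "(f, P) \<in> pi3 b \<longleftrightarrow> (\<exists>p. rotating_orbit b f P p)"
proof
  assume mem: "(f, P) \<in> pi3 b"
  obtain P0 where P0: "rotating_orbit b rotation P0 (\<lambda>i. 1 *\<^sub>R w i)"
    using rotation_rotating_orbit[of 1] by auto
  then have "((rotation, P0), (f, P)) \<in> cycle_equiv"
    using mem pi3_eq_class by auto
  then obtain h h' where c: "(f, P) \<in> cycles" and h: "h ` P0 = P"
    "\<And>x. x \<in> P0 \<Longrightarrow> h (rotation x) = f (h x)"
    "\<And>w x. w ^ 3 = 1 \<Longrightarrow> x \<in> star P0 \<Longrightarrow> x \<in> ray w \<Longrightarrow> h x \<in> ray w"
    by (rule cycle_equivE) metis
  have "rotating_orbit b f P (\<lambda>i. h (w i))"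
    unfolding rotating_orbit_def
  proof (intro conjI allI impI)
    show "f \<in> triod_maps" using c by (rule cycle_map)
    show "P = (\<lambda>i. h (w i)) ` {..<3}"
      using h(1) rotating_orbit_eq[OF P0] by (simp add: image_image)
    fix i :: nat assume i: "i < 3"
    have w: "w i \<in> P0" "w i \<in> b i" "rotation (w i) = w ((i + 1) mod 3)"
      using rotating_orbitD[OF P0 i] by auto
    show "h (w i) \<in> b i"
      using h(3)[of "w i" "w i"] w subset_star b_eq[OF i] root[OF i] by auto
    show "f (h (w i)) = h (w ((i + 1) mod 3))"
      using h(2)[OF w(1)] w(3) by simp
  qed
  then show "\<exists>p. rotating_orbit b f P p" by blast
next
  assume "\<exists>p. rotating_orbit b f P p"
  then obtain p where p: "rotating_orbit b f P p" by blast
  show "(f, P) \<in> pi3 b"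
    unfolding pi3_eq_class[OF p] using cycle_equiv_refl[OF rotating_orbit_cycle[OF p]] by simp
qed

lemma rotation_in_pi3: "\<exists>P. (rotation, P) \<in> pi3 b"
  using mem_pi3_iff rotation_rotating_orbit[of 1] by auto

lemma pi3_pattern: "pi3 b \<in> patterns"
proof -
  obtain P p where "rotating_orbit b rotation P p" using rotation_in_pi3 mem_pi3_iff by blast
  then show ?thesis
    unfolding patterns_def pi3_eq_class[OF \<open>rotating_orbit b rotation P p\<close>]
    by (intro quotientI rotating_orbit_cycle)
qed

section \<open>Invariants and forcing relations of the pattern\<close>

lemma the_elem_const_image: "A \<noteq> {} \<Longrightarrow> (\<And>x. x \<in> A \<Longrightarrow> f x = c) \<Longrightarrow> the_elem (f ` A) = c"
  by (metis image_constant_conv image_cong the_elem_eq)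

lemma rotation_number_pi3: "rotation_number b (pi3 b) = 1 / 3"
  unfolding rotation_number_def
  using rotation_in_pi3 rotating_orbit_cycle_rotation_number mem_pi3_iff
  by (intro the_elem_const_image) auto

lemma pattern_period_pi3: "pattern_period (pi3 b) = 3"
  unfolding pattern_period_def
  using rotation_in_pi3 rotating_orbit_card mem_pi3_iff
  by (intro the_elem_const_image) auto

text \<open>The rotation exhibits \<open>pi3 b\<close>, so it must exhibit every pattern forced by
  it; but all its cycles lie in \<open>pi3 b\<close>, and patterns with a common cycle
  coincide.\<close>

lemma pi3_forces_only_itself:
  assumes "B \<in> patterns" "forces (pi3 b) B"
  shows "B = pi3 b"
proof -
  obtain Q where Q: "(rotation, Q) \<in> B"
    using assms(2) rotation_maps rotation_in_pi3 unfolding forces_def by blast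
  then have "(rotation, Q) \<in> cycles"
    using assms(1) in_quotient_imp_subset[OF equiv_cycle_equiv] unfolding patterns_def by blast
  then have "(rotation, Q) \<in> pi3 b" using rotation_cycle mem_pi3_iff by blast
  then show ?thesis using pattern_eq_class[OF assms(1) Q] pattern_eq_class[OF pi3_pattern] by simp
qed

text \<open>Canonicity is required of every cycle in \<open>A\<close>, hence holds for the cycle of
  whichever map exhibits \<open>A\<close>; that same map then has a rotating orbit.\<close>

lemma canonical_forces_pi3:
  assumes "A \<in> canonical_regular_patterns b"
  shows "forces A (pi3 b)"
  unfolding forces_def
proof (intro ballI impI)
  fix f assume "\<exists>P. (f, P) \<in> A"
  then obtain P where P: "(f, P) \<in> A" by blast
  have A: "A \<in> patterns" "canonical_for_cycle b (f, P)"
    using assms P by (auto simp: canonical_regular_patterns_def regular_pattern_def)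
  then have "(f, P) \<in> cycles"
    using P in_quotient_imp_subset[OF equiv_cycle_equiv] unfolding patterns_def by blast
  then show "\<exists>Q. (f, Q) \<in> pi3 b"
    using canonical_cycle_rotating_orbit A(2) mem_pi3_iff by blast
qed

text \<open>The only pattern it forces is itself, whose period is 3 and not 2.\<close>

lemma pi3_regular: "regular_pattern (pi3 b)"
  unfolding regular_pattern_def using pi3_pattern pi3_forces_only_itself pattern_period_pi3 by force

lemma pi3_unique_twist:
  "{A \<in> canonical_regular_patterns b. triod_twist b A \<and> rotation_number b A = 1 / 3} = {pi3 b}"
proof (intro subset_antisym subsetI)
  fix A assume A: "A \<in> {A \<in> canonical_regular_patterns b. triod_twist b A \<and> rotation_number b A = 1 / 3}"
  then have "forces A (pi3 b)" using canonical_forces_pi3 by simp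
  \<comment> \<open>A twist forces no other pattern with its own rotation number.\<close>
  then have "A = pi3 b"
    using A pi3_pattern rotation_number_pi3 unfolding triod_twist_def by auto
  then show "A \<in> {pi3 b}" by simp
next
  fix A assume "A \<in> {pi3 b}"
  moreover have "triod_twist b (pi3 b)"
    unfolding triod_twist_def using pi3_regular pi3_forces_only_itself by blast
  moreover have "pi3 b \<in> canonical_regular_patterns b"
    unfolding canonical_regular_patterns_def using pi3_regular rotating_orbit_canonical
    by (auto simp: mem_pi3_iff)
  ultimately show "A \<in> {A \<in> canonical_regular_patterns b. triod_twist b A \<and> rotation_number b A = 1 / 3}"
    using rotation_number_pi3 by simp
qed

end

theorem lemma3p7:
  fixes b :: "nat \<Rightarrow> complex set"
  assumes "branch_numbering b"
  shows "{A \<in> canonical_regular_patterns b. triod_twist b A \<and> rotation_number b A = 1 / 3} = {pi3 b}"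
proof -
  obtain w where "numbered_triod b w"
    using branch_numbering_ray[OF assms] by (metis numbered_triod.intro)
  then show ?thesis by (rule numbered_triod.pi3_unique_twist)
qed

end
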